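(* Let $G$ be a finite, simple, undirected, connected graph, let $c\geq 0$ be an integer, and let $\mathcal{P}$ be a $c$-sharp partition of $G$. Let $H=G(\mathcal{P})$ be the partition-graph and $\varphi:V(G)\to V(H)$ the natural mapping. Then $\varphi$ is a $(c+1,1,0)$-quasi-isometry.
   Context: Distances $d_G$, $d_H$ are shortest-path distances (number of edges). A partition of $G$ is a partition of $V(G)$ into nonempty subsets (super-vertices), each of which induces a connected subgraph of $G$. The partition-graph $G(\mathcal{P})$ has the super-vertices as vertices, two distinct super-vertices $P_i,P_j$ being adjacent iff there exist $x\in P_i$, $y\in P_j$ with $x\sim y$ in $G$. The natural mapping is $\varphi(v)=\overline{v}$, the super-vertex containing $v$. The partition is $c$-sharp if every super-vertex, as a (connected induced) subgraph, has diameter at most $c$. For metric spaces $(M_1,d_1),(M_2,d_2)$ and non-negative integers $A,B,C$ with $A\ge 1$, a map $f:M_1\to M_2$ is an $(A,B,C)$-quasi-isometry if (Q1) for all $x,y\in M_1$: $\frac1A d_1(x,y)-B\le d_2(f(x),f(y))\le A\,d_1(x,y)+B$, and (Q2) for every $y\in M_2$ there is $x\in M_1$ with $d_2(y,f(x))\le C$. *)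

theory Defs
  imports
    "HOL-Library.Disjoint_Sets"
    "HOL-Analysis.Abstract_Metric_Spaces"
    "Graph_Theory.Graph_Theory"
begin

text \<open>
  Finite simple undirected graphs are the \<^locale>\<open>pair_graph\<close>s of the Graph-Theory entry: finite,
  loop-free, symmetric digraphs whose arcs are pairs of vertices. The name \<open>connected\<close> is qualified
  throughout because it is also a topological notion; as in the entry, a connected graph has
  at least one vertex.
\<close>

definition graph_edist :: "('a, 'b) pre_digraph \<Rightarrow> 'a \<Rightarrow> 'a \<Rightarrow> ereal" where
  "graph_edist G u v = wf_digraph.\<mu> G (\<lambda>_. 1) u v"

text \<open>
  The real-valued version is meant for connected graphs; it takes the junk value 0
  when there is no walk between the two arguments.
\<close>

definition graph_dist :: "('a, 'b) pre_digraph \<Rightarrow> 'a \<Rightarrow> 'a \<Rightarrow> real" where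
  "graph_dist G u v = real_of_ereal (graph_edist G u v)"

definition graph_diameter :: "('a, 'b) pre_digraph \<Rightarrow> ereal" where
  "graph_diameter G = (SUP u\<in>verts G. SUP v\<in>verts G. graph_edist G u v)"

lemma graph_edist_eq_length:
  assumes "wf_digraph G"
  shows "graph_edist G u v = (INF p\<in>{p. pre_digraph.awalk G u p v}. ereal (real (length p)))"
proof -
  interpret wf_digraph G by fact
  have "awalk_cost (\<lambda>_. 1) p = real (length p)" for p :: "'b list"
    by (induction p) auto
  then show ?thesis
    unfolding graph_edist_def \<mu>_def by simp
qed

definition graph_partition :: "'a pair_pre_digraph \<Rightarrow> 'a set set \<Rightarrow> bool" where
  "graph_partition G \<P> \<longleftrightarrow>
     partition_on (pverts G) \<P> \<and>
     (\<forall>X\<in>\<P>. Digraph_Component.connected (with_proj G \<restriction> X))"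

definition sharp_partition :: "nat \<Rightarrow> 'a pair_pre_digraph \<Rightarrow> 'a set set \<Rightarrow> bool" where
  "sharp_partition c G \<P> \<longleftrightarrow>
     graph_partition G \<P> \<and>
     (\<forall>X\<in>\<P>. graph_diameter (with_proj G \<restriction> X) \<le> ereal (real c))"

definition partition_graph :: "'a pair_pre_digraph \<Rightarrow> 'a set set \<Rightarrow> 'a set pair_pre_digraph" where
  "partition_graph G \<P> =
     \<lparr> pverts = \<P>,
       parcs = {(X, Y). X \<in> \<P> \<and> Y \<in> \<P> \<and> X \<noteq> Y \<and> (\<exists>x\<in>X. \<exists>y\<in>Y. (x, y) \<in> parcs G)} \<rparr>"

definition natural_map :: "'a set set \<Rightarrow> 'a \<Rightarrow> 'a set" where
  "natural_map \<P> v = (THE X. X \<in> \<P> \<and> v \<in> X)"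

lemma natural_map_eqI:
  assumes "partition_on V \<P>" "X \<in> \<P>" "v \<in> X"
  shows "natural_map \<P> v = X"
  unfolding natural_map_def
proof (rule the_equality)
  fix Y assume "Y \<in> \<P> \<and> v \<in> Y"
  then show "Y = X"
    using assms disjointD[OF partition_onD2[OF assms(1)], of Y X] by blast
qed (use assms in simp)

lemma pair_graph_partition_graph:
  assumes "pair_graph G" "graph_partition G \<P>"
  shows "pair_graph (partition_graph G \<P>)"
proof -
  interpret G: pair_graph G by fact
  have P: "partition_on (pverts G) \<P>"
    using assms(2) by (simp add: graph_partition_def)
  have fin: "finite \<P>"
    using P G.pair_finite_verts by (metis finite_UnionD partition_onD1)
  show ?thesis
  proof unfold_locales
    show "finite (parcs (partition_graph G \<P>))"
      by (rule finite_subset[of _ "\<P> \<times> \<P>"]) (auto simp: partition_graph_def fin)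
    show "symmetric (with_proj (partition_graph G \<P>))"
      by (auto simp: symmetric_def partition_graph_def intro!: symI dest: G.arcs_symmetric)
  qed (auto simp: partition_graph_def fin)
qed

text \<open>
  The notion only applies to maps between metric spaces, so this is part of the predicate.
  \<^locale>\<open>Metric_space\<close> requires nonnegativity and symmetry even off the carrier, where the
  junk value 0 of \<^const>\<open>graph_dist\<close> satisfies them.
\<close>

definition quasi_isometry ::
    "nat \<Rightarrow> nat \<Rightarrow> nat \<Rightarrow> 'a set \<Rightarrow> ('a \<Rightarrow> 'a \<Rightarrow> real) \<Rightarrow> 'b set \<Rightarrow> ('b \<Rightarrow> 'b \<Rightarrow> real) \<Rightarrow>
     ('a \<Rightarrow> 'b) \<Rightarrow> bool" where
  "quasi_isometry A B C M\<^sub>1 d\<^sub>1 M\<^sub>2 d\<^sub>2 f \<longleftrightarrow>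
     A \<ge> 1 \<and> Metric_space M\<^sub>1 d\<^sub>1 \<and> Metric_space M\<^sub>2 d\<^sub>2 \<and> f \<in> M\<^sub>1 \<rightarrow> M\<^sub>2 \<and>
     (\<forall>x\<in>M\<^sub>1. \<forall>y\<in>M\<^sub>1.
        1 / real A * d\<^sub>1 x y - real B \<le> d\<^sub>2 (f x) (f y) \<and>
        d\<^sub>2 (f x) (f y) \<le> real A * d\<^sub>1 x y + real B) \<and>
     (\<forall>y\<in>M\<^sub>2. \<exists>x\<in>M\<^sub>1. d\<^sub>2 y (f x) \<le> real C)"

end

theory Submission
  imports Defs
begin

text \<open>
  Mapping a walk of \<open>G\<close> to the super-vertices it visits and dropping the steps that stay inside
  one super-vertex yields a walk of \<open>H\<close> that is no longer, so the natural map is nonexpanding.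
  Conversely a walk of length \<open>n\<close> in \<open>H\<close> lifts to \<open>n\<close> arcs of \<open>G\<close>, joined by \<open>n + 1\<close> walks of
  length at most \<open>c\<close> inside the super-vertices visited; hence
  \<open>d\<^sub>G(x, y) \<le> (c + 1) d\<^sub>H(\<phi>(x), \<phi>(y)) + c\<close>.
\<close>

section \<open>Walk lengths and distances in digraphs\<close>

context wf_digraph
begin

lemma graph_edist_nonneg: "0 \<le> graph_edist G u v"
  by (simp add: graph_edist_eq_length[OF wf_digraph_axioms] INF_greatest)

lemma graph_dist_nonneg: "0 \<le> graph_dist G u v"
  by (simp add: graph_dist_def graph_edist_nonneg real_of_ereal_pos)

text \<open>Lengths are integers, so an infimum strictly below \<open>Suc n\<close> already yields a
  walk with at most \<open>n\<close> arcs. A finite bound on the extended distance also rules out an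
  empty set of walks.\<close>

lemma awalk_of_graph_edist_le:
  assumes "graph_edist G u v \<le> ereal (real n)"
  obtains p where "awalk u p v" "length p \<le> n"
proof -
  have "(INF p\<in>{p. awalk u p v}. ereal (real (length p))) < ereal (real (Suc n))"
    using assms by (simp add: graph_edist_eq_length[OF wf_digraph_axioms] le_less_trans)
  then obtain p where "awalk u p v" "length p < Suc n"
    unfolding INF_less_iff by auto
  then show thesis
    using that by simp
qed

text \<open>Among the walks from \<open>u\<close> to \<open>v\<close> one of least length exists.
  Reachability is what keeps \<open>graph_dist\<close> away from its default value 0.\<close>

lemma graph_dist_attained:
  assumes "u \<rightarrow>\<^sup>* v"
  obtains p where "awalk u p v" "graph_dist G u v = real (length p)"
proof -
  obtain q where "awalk u q v"
    using assms by (auto simp: reachable_awalk)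
  then obtain p where p: "awalk u p v" and le: "\<And>q. awalk u q v \<Longrightarrow> length p \<le> length q"
    using ex_has_least_nat[of "\<lambda>p. awalk u p v" q length] by blast
  have "graph_edist G u v = ereal (real (length p))"
    unfolding graph_edist_eq_length[OF wf_digraph_axioms]
    by (intro antisym INF_lower INF_greatest) (use p le in auto)
  with p show thesis
    using that by (simp add: graph_dist_def)
qed

lemma graph_dist_le_length:
  assumes "awalk u p v"
  shows "graph_dist G u v \<le> real (length p)"
proof -
  have "graph_edist G u v \<le> ereal (real (length p))"
    unfolding graph_edist_eq_length[OF wf_digraph_axioms] by (intro INF_lower) (use assms in simp)
  then show ?thesis
    \<comment> \<open>Lying between 0 and a real number, the extended distance is finite, so
      \<open>real_of_ereal\<close> preserves the inequality.\<close>
    using graph_edist_nonneg[of u v] by (cases "graph_edist G u v") (auto simp: graph_dist_def)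
qed

end

section \<open>Graph distance as a metric\<close>

lemma length_rev_path [simp]: "length (rev_path p) = length p"
  by (induction p) auto

lemma pverts_partition_graph [simp]: "pverts (partition_graph G \<P>) = \<P>"
  by (simp add: partition_graph_def)

text \<open>Reversing a walk keeps its length. Comparing the infima directly also covers pairs
  joined by no walk, as \<open>Metric_space\<close> demands symmetry off the carrier.\<close>

lemma (in pair_sym_digraph) graph_dist_commute: "graph_dist G u v = graph_dist G v u"
proof -
  have "graph_edist G x y \<le> graph_edist G y x" for x y
    unfolding graph_edist_eq_length[OF wf_digraph_axioms]
  proof (rule INF_mono)
    fix p assume "p \<in> {p. awalk y p x}"
    then show "\<exists>q\<in>{p. awalk x p y}. ereal (real (length q)) \<le> ereal (real (length p))"
      by (intro bexI[of _ "rev_path p"]) simp_all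
  qed
  then show ?thesis
    unfolding graph_dist_def by (metis antisym)
qed

text \<open>Distances between vertices are lengths of shortest walks: length 0 forces equal
  endpoints, and concatenation gives the triangle inequality.\<close>

lemma (in pair_sym_digraph) Metric_space_graph_dist:
  assumes "strongly_connected G"
  shows "Metric_space (pverts G) (graph_dist G)"
proof
  have reach: "x \<rightarrow>\<^sup>*\<^bsub>with_proj G\<^esub> y" if "x \<in> pverts G" "y \<in> pverts G" for x y
    using assms that by (auto simp: strongly_connected_def)
  fix x y z
  show "0 \<le> graph_dist G x y"
    by (rule graph_dist_nonneg)
  show "graph_dist G x y = graph_dist G y x"
    by (rule graph_dist_commute)
  assume x: "x \<in> pverts G" and y: "y \<in> pverts G"
  obtain p where p: "awalk x p y" "graph_dist G x y = real (length p)"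
    using graph_dist_attained[OF reach[OF x y]] .
  show "graph_dist G x y = 0 \<longleftrightarrow> x = y"
  proof
    assume "graph_dist G x y = 0"
    with p show "x = y"
      by (simp add: awalk_Nil_iff)
  next
    assume "x = y"
    with x have "awalk x [] y"
      by (simp add: awalk_Nil_iff)
    from graph_dist_le_length[OF this] show "graph_dist G x y = 0"
      using graph_dist_nonneg[of x y] by simp
  qed
  assume z: "z \<in> pverts G"
  obtain q where q: "awalk y q z" "graph_dist G y z = real (length q)"
    using graph_dist_attained[OF reach[OF y z]] .
  show "graph_dist G x z \<le> graph_dist G x y + graph_dist G y z"
    using graph_dist_le_length[OF awalk_appendI[OF p(1) q(1)]] p(2) q(2) by simp
qed

section \<open>Walks in the graph and in its partition-graph\<close>

lemma natural_map_in:
  assumes "partition_on V \<P>" "v \<in> V"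
  shows "natural_map \<P> v \<in> \<P>" "v \<in> natural_map \<P> v"
proof -
  obtain X where "X \<in> \<P>" "v \<in> X"
    using assms by (auto simp: partition_on_def)
  with natural_map_eqI[OF assms(1) this] show "natural_map \<P> v \<in> \<P>" "v \<in> natural_map \<P> v"
    by simp_all
qed

lemma (in pair_wf_digraph) awalk_induce_subgraphD:
  assumes "pre_digraph.awalk (G \<restriction> X) u p v" "X \<subseteq> pverts G"
  shows "awalk u p v"
  using subgraph_awalk_imp_awalk[OF assms(1)] assms(2) by (simp add: subgraph_induce_subgraphI)

lemma (in pair_wf_digraph) awalk_partition_graph:
  assumes part: "partition_on (pverts G) \<P>" and H: "pair_wf_digraph (partition_graph G \<P>)"
    and "awalk u p v"
  shows "\<exists>q. pre_digraph.awalk (partition_graph G \<P>) (natural_map \<P> u) q (natural_map \<P> v) \<and>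
    length q \<le> length p"
  using \<open>awalk u p v\<close>
proof (induction p arbitrary: u)
  interpret H: pair_wf_digraph "partition_graph G \<P>" by (rule H)
  {
    case Nil
    then have "u = v" "u \<in> pverts G"
      by (auto simp: awalk_Nil_iff)
    with natural_map_in(1)[OF part, of u] have "H.awalk (natural_map \<P> u) [] (natural_map \<P> v)"
      by (simp add: H.awalk_Nil_iff)
    then show ?case
      by (intro exI[of _ "[]"]) simp
  next
    case (Cons e p)
    then obtain w where e: "e = (u, w)" "(u, w) \<in> parcs G" and "awalk w p v"
      by (cases e) (auto simp: awalk_Cons_iff)
    with Cons.IH obtain q where
      q: "H.awalk (natural_map \<P> w) q (natural_map \<P> v)" "length q \<le> length p"
      by blast
    show ?case
    proof (cases "natural_map \<P> u = natural_map \<P> w")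
      case True
      \<comment> \<open>The partition-graph has no loops, so an arc inside one super-vertex is
        dropped; hence the length bound is only an inequality.\<close>
      with q show ?thesis
        by (intro exI[of _ q]) simp
    next
      case False
      with e(2) have "(natural_map \<P> u, natural_map \<P> w) \<in> parcs (partition_graph G \<P>)"
        using natural_map_in[OF part in_arcsD1[OF e(2)]] natural_map_in[OF part in_arcsD2[OF e(2)]]
        by (auto simp: partition_graph_def)
      with q have "H.awalk (natural_map \<P> u) ((natural_map \<P> u, natural_map \<P> w) # q) (natural_map \<P> v)"
        by (simp add: H.awalk_Cons_iff)
      with q(2) show ?thesis
        by (metis Suc_le_mono length_Cons)
    qed
  }
qed

text \<open>The diameter bound is measured in the induced subgraph, whose walks are also walks of
  \<open>G\<close>.\<close>

lemma (in pair_wf_digraph) awalk_within_super_vertex: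
  assumes "sharp_partition c G \<P>" "X \<in> \<P>" "x \<in> X" "y \<in> X"
  obtains p where "awalk x p y" "length p \<le> c"
proof -
  interpret X: wf_digraph "G \<restriction> X" by auto
  have "graph_edist (G \<restriction> X) x y \<le> graph_diameter (G \<restriction> X)"
    unfolding graph_diameter_def
    by (rule SUP_upper2[of x], use assms in simp, rule SUP_upper, use assms in simp)
  also have "\<dots> \<le> ereal (real c)"
    using assms by (simp add: sharp_partition_def)
  finally obtain p where "X.awalk x p y" "length p \<le> c"
    by (rule X.awalk_of_graph_edist_le)
  moreover have "X \<subseteq> pverts G"
    using assms by (auto simp: sharp_partition_def graph_partition_def partition_on_def)
  ultimately show thesis
    using that awalk_induce_subgraphD by blast
qed

text \<open>Each arc of \<open>q\<close> costs one arc of \<open>G\<close> and at most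
  \<open>c\<close> arcs to reach its tail; the last super-vertex costs \<open>c\<close> more. The
  start \<open>x\<close> is generalised, since a lifted arc may enter the next super-vertex
  anywhere.\<close>

lemma (in pair_wf_digraph) lift_awalk_partition_graph:
  assumes sharp: "sharp_partition c G \<P>" and H: "pair_wf_digraph (partition_graph G \<P>)"
    and "pre_digraph.awalk (partition_graph G \<P>) X q Y" "x \<in> X" "y \<in> Y"
  shows "\<exists>p. awalk x p y \<and> length p \<le> (c + 1) * length q + c"
  using assms(3,4)
proof (induction q arbitrary: X x)
  interpret H: pair_wf_digraph "partition_graph G \<P>" by (rule H)
  {
    case Nil
    then have X: "X \<in> \<P>" and "y \<in> X"
      using \<open>y \<in> Y\<close> by (auto simp: H.awalk_Nil_iff)
    obtain p where "awalk x p y" "length p \<le> c"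
      using awalk_within_super_vertex[OF sharp X \<open>x \<in> X\<close> \<open>y \<in> X\<close>] .
    then show ?case
      by (intro exI[of _ p]) simp
  next
    case (Cons e q)
    then obtain Z where e: "(X, Z) \<in> parcs (partition_graph G \<P>)" and Z: "H.awalk Z q Y"
      by (cases e) (auto simp: H.awalk_Cons_iff)
    then obtain x' z where "X \<in> \<P>" "x' \<in> X" "z \<in> Z" and arc: "(x', z) \<in> parcs G"
      by (auto simp: partition_graph_def)
    \<comment> \<open>The lifted arc leaves \<open>X\<close> at \<open>x'\<close>, possibly
      different from \<open>x\<close>; a walk inside \<open>X\<close> closes the gap.\<close>
    obtain p\<^sub>1 where p1: "awalk x p\<^sub>1 x'" "length p\<^sub>1 \<le> c"
      using awalk_within_super_vertex[OF sharp \<open>X \<in> \<P>\<close> \<open>x \<in> X\<close> \<open>x' \<in> X\<close>] .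
    obtain p\<^sub>2 where p2: "awalk z p\<^sub>2 y" "length p\<^sub>2 \<le> (c + 1) * length q + c"
      using Cons.IH[OF Z \<open>z \<in> Z\<close>] by blast
    have "awalk x' ((x', z) # p\<^sub>2) y"
      using p2(1) arc by (simp add: awalk_Cons_iff)
    with p1(1) have "awalk x (p\<^sub>1 @ (x', z) # p\<^sub>2) y"
      by (rule awalk_appendI)
    moreover have "length (p\<^sub>1 @ (x', z) # p\<^sub>2) \<le> (c + 1) * length (e # q) + c"
      using p1(2) p2(2) by simp
    ultimately show ?case
      by (intro exI conjI)
  }
qed

text \<open>Choose representatives of the two super-vertices and project a walk of \<open>G\<close>
  that joins them.\<close>

lemma (in pair_wf_digraph) strongly_connected_partition_graph:
  assumes "strongly_connected G" and part: "partition_on (pverts G) \<P>"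
    and H: "pair_wf_digraph (partition_graph G \<P>)"
  shows "strongly_connected (partition_graph G \<P>)"
proof
  interpret H: pair_wf_digraph "partition_graph G \<P>" by (rule H)
  show "verts (partition_graph G \<P>) \<noteq> {}"
    using assms(1) part by (auto simp: strongly_connected_def partition_on_def)
  fix X Y
  assume "X \<in> verts (partition_graph G \<P>)" "Y \<in> verts (partition_graph G \<P>)"
  then have XY: "X \<in> \<P>" "Y \<in> \<P>"
    by simp_all
  then obtain x y where xy: "x \<in> X" "y \<in> Y"
    using part by (metis all_not_in_conv partition_onD3)
  then have "x \<in> pverts G" "y \<in> pverts G"
    using XY part by (auto simp: partition_on_def)
  with assms(1) obtain p where "awalk x p y"
    by (auto simp: strongly_connected_def reachable_awalk)
  from awalk_partition_graph[OF part H this]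
  show "X \<rightarrow>\<^sup>*\<^bsub>with_proj (partition_graph G \<P>)\<^esub> Y"
    unfolding H.reachable_awalk using XY xy natural_map_eqI[OF part] by auto
qed

section \<open>The quasi-isometry inequalities\<close>

theorem theorem2:
  fixes G :: "'a pair_pre_digraph" and c :: nat and \<P> :: "'a set set"
  assumes "pair_graph G"
    and "Digraph_Component.connected (with_proj G)"
    and "sharp_partition c G \<P>"
  defines "H \<equiv> partition_graph G \<P>"
  shows "quasi_isometry (c + 1) 1 0
           (pverts G) (graph_dist (with_proj G))
           (pverts H) (graph_dist (with_proj H))
           (natural_map \<P>)"
proof -
  have gp: "graph_partition G \<P>" and part: "partition_on (pverts G) \<P>"
    using assms(3) by (simp_all add: sharp_partition_def graph_partition_def)
  interpret G: pair_graph G by fact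
  interpret H: pair_graph H
    unfolding H_def using assms(1) gp by (rule pair_graph_partition_graph)
  note wfH = H.pair_wf_digraph_axioms[unfolded H_def]
  have scG: "strongly_connected G"
    using G.sym_arcs assms(2) by (rule G.symmetric_connected_imp_strongly_connected)
  have scH: "strongly_connected H"
    unfolding H_def by (rule G.strongly_connected_partition_graph[OF scG part wfH])
  have vertsH: "pverts H = \<P>"
    by (simp add: H_def)
  interpret MH: Metric_space "pverts H" "graph_dist H"
    by (rule H.Metric_space_graph_dist[OF scH])
  let ?\<phi> = "natural_map \<P>"
  have upper: "graph_dist H (?\<phi> x) (?\<phi> y) \<le> graph_dist G x y"
    if xy: "x \<in> pverts G" "y \<in> pverts G" for x y
  proof -
    have "x \<rightarrow>\<^sup>*\<^bsub>with_proj G\<^esub> y"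
      using scG xy by (auto simp: strongly_connected_def)
    then obtain p where p: "G.awalk x p y" "graph_dist G x y = real (length p)"
      by (rule G.graph_dist_attained)
    obtain q where q: "H.awalk (?\<phi> x) q (?\<phi> y)" "length q \<le> length p"
      using G.awalk_partition_graph[OF part wfH p(1)] unfolding H_def by blast
    then show ?thesis
      using H.graph_dist_le_length[OF q(1)] p(2) by linarith
  qed
  have lower: "graph_dist G x y \<le> real (c + 1) * graph_dist H (?\<phi> x) (?\<phi> y) + real c"
    if xy: "x \<in> pverts G" "y \<in> pverts G" for x y
  proof -
    have "?\<phi> x \<rightarrow>\<^sup>*\<^bsub>with_proj H\<^esub> ?\<phi> y"
      using scH natural_map_in(1)[OF part] xy by (auto simp: strongly_connected_def vertsH)
    then obtain q where q: "H.awalk (?\<phi> x) q (?\<phi> y)"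
        "graph_dist H (?\<phi> x) (?\<phi> y) = real (length q)"
      by (rule H.graph_dist_attained)
    then obtain p where p: "G.awalk x p y" "length p \<le> (c + 1) * length q + c"
      using G.lift_awalk_partition_graph[OF assms(3) wfH] natural_map_in(2)[OF part] xy
      unfolding H_def by blast
    have "graph_dist G x y \<le> real ((c + 1) * length q + c)"
      using G.graph_dist_le_length[OF p(1)] p(2) by linarith
    then show ?thesis
      by (simp add: q(2) algebra_simps)
  qed
  show ?thesis
    unfolding quasi_isometry_def
  proof (intro conjI ballI)
    show "Metric_space (pverts G) (graph_dist G)"
      by (rule G.Metric_space_graph_dist[OF scG])
    show "Metric_space (pverts H) (graph_dist H)"
      by (rule MH.Metric_space_axioms)
    show "?\<phi> \<in> pverts G \<rightarrow> pverts H"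
      using natural_map_in(1)[OF part] by (simp add: vertsH)
  next
    fix x y assume xy: "x \<in> pverts G" "y \<in> pverts G"
    \<comment> \<open>Rounding the additive \<open>c\<close> up to \<open>c + 1\<close> lets the
      factor be taken out; dividing by it leaves the additive constant 1.\<close>
    have "graph_dist G x y \<le> real (c + 1) * (graph_dist H (?\<phi> x) (?\<phi> y) + 1)"
      using lower[OF xy] by (simp add: algebra_simps)
    then show "1 / real (c + 1) * graph_dist G x y - real 1 \<le> graph_dist H (?\<phi> x) (?\<phi> y)"
      by (simp add: field_simps)
    have "graph_dist G x y \<le> real (c + 1) * graph_dist G x y"
      using G.graph_dist_nonneg[of x y] by (simp add: algebra_simps)
    with upper[OF xy]
    show "graph_dist H (?\<phi> x) (?\<phi> y) \<le> real (c + 1) * graph_dist G x y + real 1"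
      by simp
  next
    fix Y assume Y: "Y \<in> pverts H"
    \<comment> \<open>Super-vertices are nonempty, so the natural map is onto, which gives the
      constant 0 in (Q2).\<close>
    then obtain y where y: "y \<in> Y"
      using part vertsH by (metis all_not_in_conv partition_onD3)
    with Y have "y \<in> pverts G" "?\<phi> y = Y"
      using part natural_map_eqI[OF part] by (auto simp: vertsH partition_on_def)
    with Y show "\<exists>x\<in>pverts G. graph_dist H Y (?\<phi> x) \<le> real 0"
      by (intro bexI[of _ y]) simp_all
  qed simp
qed

end
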